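(* As formal power series in $z$, $$\frac{A(x,2z)}{A(x,z)}=C^E(x,z),\qquad \frac{B(x,z)}{A(x,z)}=1+xC^O(x,z).$$
   Context: $A_n(x)=\sum_{\pi\in\mathcal{S}_n}x^{{\rm des}_A(\pi)}$ is the Eulerian polynomial ($\mathcal{S}_n$ the symmetric group, ${\rm des}_A(\pi)=\#\{i\in[n-1]:\pi(i)>\pi(i+1)\}$, $A_0=1$), and $B_n(x)=\sum_{\pi\in\mathcal{S}^B_n}x^{{\rm des}_B(\pi)}$ is the type $B$ Eulerian polynomial, where $\mathcal{S}^B_n$ is the set of signed permutations of $\pm[n]$ (with $\pi(-i)=-\pi(i)$) and ${\rm des}_B(\pi)=\#\{i\in\{0,\ldots,n-1\}:\pi(i)>\pi(i+1)\}$ with $\pi(0)=0$; $B_0=1$. Let $A(x,z)=\sum_{n\ge0}A_n(x)\frac{z^n}{n!}$, $B(x,z)=\sum_{n\ge0}B_n(x)\frac{z^n}{n!}$. For $n\ge1$ let $C_n^+=\{\pi\in\mathcal{S}^B_n:\pi(1)>0\}$, $C_n^-=\{\pi\in\mathcal{S}^B_n:\pi(1)<0\}$, $C_n^E(x)=\sum_{\pi\in C_n^+}x^{{\rm des}_A(\pi)}$, $C_n^O(x)=\sum_{\pi\in C_n^-}x^{{\rm des}_A(\pi)}$ (with ${\rm des}_A$ of a signed permutation $\pi(1)\cdots\pi(n)$ computed in the usual integer order), and let $C^E(x,z)=1+\sum_{n\ge1}C_n^E(x)\frac{z^n}{n!}$, $C^O(x,z)=\sum_{n\ge1}C_n^O(x)\frac{z^n}{n!}$.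 *)

theory Defs
  imports
    "HOL-Computational_Algebra.Computational_Algebra"
    "HOL-Combinatorics.Permutations"
begin

text \<open>
  Permutations of \<open>[n]\<close> and of \<open>\<plusminus>[n]\<close> are both functions on \<^typ>\<open>int\<close> that are the identity
  outside their ground set, so that \<open>des_A\<close> applies to either kind, and a signed permutation
  automatically satisfies the convention \<open>\<pi> 0 = 0\<close> that \<open>des_B\<close> relies on.
\<close>

definition sym_perms :: "nat \<Rightarrow> (int \<Rightarrow> int) set" where
  "sym_perms n = {\<pi>. \<pi> permutes {1..int n}}"

definition signed_perms :: "nat \<Rightarrow> (int \<Rightarrow> int) set" where
  "signed_perms n = {\<pi>. \<pi> permutes ({- int n..int n} - {0}) \<and> (\<forall>i. \<pi> (- i) = - \<pi> i)}"

definition des_A :: "nat \<Rightarrow> (int \<Rightarrow> int) \<Rightarrow> nat" where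
  "des_A n \<pi> = card {i \<in> {1..int n - 1}. \<pi> i > \<pi> (i + 1)}"

definition des_B :: "nat \<Rightarrow> (int \<Rightarrow> int) \<Rightarrow> nat" where
  "des_B n \<pi> = card {i \<in> {0..int n - 1}. \<pi> i > \<pi> (i + 1)}"

definition C_plus :: "nat \<Rightarrow> (int \<Rightarrow> int) set" where
  "C_plus n = {\<pi> \<in> signed_perms n. \<pi> 1 > 0}"

definition C_minus :: "nat \<Rightarrow> (int \<Rightarrow> int) set" where
  "C_minus n = {\<pi> \<in> signed_perms n. \<pi> 1 < 0}"

definition A_poly :: "nat \<Rightarrow> rat poly" where
  "A_poly n = (\<Sum>\<pi>\<in>sym_perms n. monom 1 (des_A n \<pi>))"

definition B_poly :: "nat \<Rightarrow> rat poly" where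
  "B_poly n = (\<Sum>\<pi>\<in>signed_perms n. monom 1 (des_B n \<pi>))"

definition CE_poly :: "nat \<Rightarrow> rat poly" where
  "CE_poly n = (\<Sum>\<pi>\<in>C_plus n. monom 1 (des_A n \<pi>))"

definition CO_poly :: "nat \<Rightarrow> rat poly" where
  "CO_poly n = (\<Sum>\<pi>\<in>C_minus n. monom 1 (des_A n \<pi>))"

text \<open>
  The power series variable is \<open>z\<close>. The coefficient ring \<open>\<rat>[x]\<close> is embedded (injectively) into
  its fraction field \<open>\<rat>(x)\<close>, because division of formal power series is available over fields.
\<close>

definition egf :: "(nat \<Rightarrow> rat poly) \<Rightarrow> rat poly fract fps" where
  "egf p = Abs_fps (\<lambda>n. to_fract (p n) / fact n)"

definition x_var :: "rat poly fract fps" where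
  "x_var = fps_const (to_fract [:0, 1:])"

definition A_gf :: "rat poly fract fps" where
  "A_gf = egf A_poly"

definition B_gf :: "rat poly fract fps" where
  "B_gf = egf B_poly"

definition CE_gf :: "rat poly fract fps" where
  "CE_gf = egf (\<lambda>n. if n = 0 then 1 else CE_poly n)"

definition CO_gf :: "rat poly fract fps" where
  "CO_gf = egf (\<lambda>n. if n = 0 then 0 else CO_poly n)"

lemma finite_sym_perms: "finite (sym_perms n)"
  unfolding sym_perms_def by (intro finite_permutations) simp

lemma finite_signed_perms: "finite (signed_perms n)"
  by (rule finite_subset[OF _ finite_permutations[of "{- int n..int n} - {0}"]])
     (auto simp: signed_perms_def)

lemma signed_perms_zero: "\<pi> \<in> signed_perms n \<Longrightarrow> \<pi> 0 = 0"
  by (auto simp: signed_perms_def permutes_def)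

lemma A_poly_0: "A_poly 0 = 1"
  by (simp add: A_poly_def sym_perms_def des_A_def)

lemma B_poly_0: "B_poly 0 = 1"
proof -
  have "signed_perms 0 = {id}"
    by (auto simp: signed_perms_def)
  then show ?thesis
    by (simp add: B_poly_def des_B_def)
qed

text \<open>The denominator \<open>A(x,z)\<close> is a unit.\<close>

lemma A_gf_nth_0: "fps_nth A_gf 0 = 1"
  by (simp add: A_gf_def egf_def A_poly_0)

end

theory Submission
  imports Defs "HOL-Combinatorics.Multiset_Permutations"
begin

text \<open>
  Write a signed permutation as a word \<open>\<pi>(1)\<dots>\<pi>(n)\<close>. Cutting it after its longest prefix of negative
  letters splits it into an arbitrary arrangement of a set of \<open>k\<close> negative letters and a word on the
  remaining absolute values that is empty or starts with a positive letter. There is no descent at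
  the cut, so the sum of \<open>x ^ des\<close> over all signed permutations, which is \<open>2\<^sup>n A\<^sub>n(x)\<close> since for every
  choice of the signed letters all arrangements occur, is the binomial convolution of \<open>A\<^sub>k\<close> and \<open>C\<^sup>E\<close>.
  Cutting after the longest prefix of positive letters instead, the type B statistic has exactly one
  descent at the cut (or at position 0) whenever the second part is nonempty; this yields \<open>B\<^sub>n\<close> as the
  convolution of \<open>A\<^sub>k\<close> and \<open>1 + x C\<^sup>O\<close>.
\<close>

section \<open>Descents of words\<close>

fun des :: "int list \<Rightarrow> nat" where
  "des (x # y # l) = (if x > y then 1 else 0) + des (y # l)"
| "des l = 0"

lemma des_append:
  "u \<noteq> [] \<Longrightarrow> v \<noteq> [] \<Longrightarrow> des (u @ v) = des u + (if last u > hd v then 1 else 0) + des v"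
proof (induction u rule: des.induct)
  case ("2_2" x)
  then show ?case by (cases v) auto
qed auto

lemma des_map_strict_mono_on:
  assumes "strict_mono_on S f" "set l \<subseteq> S"
  shows "des (map f l) = des l"
  using assms(2)
  by (induction l rule: des.induct) (use assms(1) in \<open>auto simp: strict_mono_on_less\<close>)

text \<open>The lower end stays general because \<open>des_A\<close> starts counting at position 1
  and \<open>des_B\<close> at position 0.\<close>

lemma des_map_upto: "des (map p [a..b]) = card {i \<in> {a..b - 1}. p i > p (i + 1)}"
proof (cases "a \<le> b")
  case True
  then show ?thesis
  proof (induction b rule: int_ge_induct)
    case base
    then show ?case by simp
  next
    case (step b)
    let ?D = "{i \<in> {a..b - 1}. p i > p (i + 1)}"
    have "{i \<in> {a..b + 1 - 1}. p i > p (i + 1)} = (if p b > p (b + 1) then insert b ?D else ?D)"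
      using step.hyps by (auto simp: order_le_less)
    moreover have "card (insert b ?D) = Suc (card ?D)"
      by (rule card_insert_disjoint) (auto intro: finite_subset[of _ "{a..b}"])
    moreover have "map p [a..b + 1] = map p [a..b] @ [p (b + 1)]"
      using step.hyps by (simp add: upto_rec2)
    moreover have "last (map p [a..b]) = p b" "map p [a..b] \<noteq> []"
      using step.hyps by (auto simp: upto_rec2[of a b])
    ultimately show ?case
      using step.IH by (simp add: des_append)
  qed
qed auto

section \<open>Permutations and signed permutations as words\<close>

text \<open>The set \<open>S\<close> of absolute values is arbitrary because cutting off a prefix
  leaves absolute values that need not form an interval.\<close>

definition signed_words :: "int set \<Rightarrow> int list set" where
  "signed_words S = {l. distinct (map abs l) \<and> abs ` set l = S}"

lemma finite_signed_words:
  assumes "finite S"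
  shows "finite (signed_words S)"
proof (rule finite_subset)
  show "signed_words S \<subseteq> {l. set l \<subseteq> S \<union> uminus ` S \<and> length l = card S}"
  proof
    fix l assume l: "l \<in> signed_words S"
    then have "length l = card S"
      unfolding signed_words_def by (metis (mono_tags, lifting) distinct_card length_map list.set_map mem_Collect_eq)
    moreover have "x \<in> S \<union> uminus ` S" if "x \<in> set l" for x
    proof -
      have "\<bar>x\<bar> \<in> S" using l that by (auto simp: signed_words_def)
      then show ?thesis by (cases "x \<ge> 0") (auto simp: image_iff intro: bexI[of _ "-x"])
    qed
    ultimately show "l \<in> {l. set l \<subseteq> S \<union> uminus ` S \<and> length l = card S}" by auto
  qed
  show "finite {l. set l \<subseteq> S \<union> uminus ` S \<and> length l = card S}"
    using assms by (intro finite_lists_length_eq) auto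
qed

text \<open>A surjection of a finite set onto itself is injective, so computing the image
  suffices.\<close>

lemma permutes_if_image_eq:
  assumes "finite S" "p ` S = S" "\<And>i. i \<notin> S \<Longrightarrow> p i = i"
  shows "p permutes S"
  using assms by (intro bij_imp_permutes) (auto simp: bij_betw_def intro: eq_card_imp_inj_on)

lemma set_conv_nth_int: "set l = (\<lambda>i. l ! nat (i - 1)) ` {1..int (length l)}"
proof -
  have "{..<length l} = (\<lambda>i. nat (i - 1)) ` {1..int (length l)}"
    by (auto simp: image_iff intro!: bexI[of _ "int _ + 1"])
  moreover have "set l = (!) l ` {..<length l}"
    by (auto simp: set_conv_nth)
  ultimately show ?thesis
    by (simp only: image_image)
qed

lemma bij_betw_sym_perms:
  "bij_betw (\<lambda>p. map p [1..int n]) (sym_perms n) (permutations_of_set {1..int n})"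
proof (rule bij_betwI')
  fix p q assume "p \<in> sym_perms n" "q \<in> sym_perms n"
  then show "map p [1..int n] = map q [1..int n] \<longleftrightarrow> p = q"
    by (auto simp: sym_perms_def permutes_def fun_eq_iff)
next
  fix p assume "p \<in> sym_perms n"
  then have "p permutes {1..int n}" by (simp add: sym_perms_def)
  then show "map p [1..int n] \<in> permutations_of_set {1..int n}"
    by (auto simp: permutations_of_set_def distinct_map permutes_image permutes_inj_on)
next
  fix l assume "l \<in> permutations_of_set {1..int n}"
  then have l: "set l = {1..int n}" "length l = n"
    by (auto simp: permutations_of_set_def distinct_card[symmetric])
  define p where "p i = (if i \<in> {1..int n} then l ! nat (i - 1) else i)" for i
  have "p ` {1..int n} = {1..int n}"
    using set_conv_nth_int[of l] l by (simp add: p_def cong: image_cong_simp)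
  then have "p permutes {1..int n}"
    by (intro permutes_if_image_eq) (auto simp: p_def)
  moreover have "l = map p [1..int n]"
    using l by (auto simp: p_def intro!: nth_equalityI)
  ultimately show "\<exists>p\<in>sym_perms n. l = map p [1..int n]"
    by (auto simp: sym_perms_def)
qed

text \<open>Oddness makes the values at \<open>1..n\<close> determine the whole function;
  conversely, a signed word has exactly one odd extension that is the identity off the ground
  set.\<close>

lemma bij_betw_signed_perms:
  "bij_betw (\<lambda>p. map p [1..int n]) (signed_perms n) (signed_words {1..int n})"
proof (rule bij_betwI')
  fix p q assume pq: "p \<in> signed_perms n" "q \<in> signed_perms n"
  show "map p [1..int n] = map q [1..int n] \<longleftrightarrow> p = q"
  proof
    assume eq: "map p [1..int n] = map q [1..int n]"
    show "p = q"
    proof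
      fix i
      consider "i \<in> {1..int n}" | "- i \<in> {1..int n}" | "i \<notin> {- int n..int n} - {0}" by fastforce
      then show "p i = q i"
      proof cases
        case 2
        then have "p (- i) = q (- i)" using eq by auto
        then show ?thesis using pq by (simp add: signed_perms_def)
      qed (use eq pq in \<open>auto simp: signed_perms_def permutes_def\<close>)
    qed
  qed simp
next
  fix p assume "p \<in> signed_perms n"
  then have p: "p permutes ({- int n..int n} - {0})" and odd: "\<And>i. p (- i) = - p i"
    by (auto simp: signed_perms_def)
  have inj: "p i = p j \<longleftrightarrow> i = j" for i j using p by (metis permutes_def)
  have "inj_on (\<lambda>i. \<bar>p i\<bar>) {1..int n}"
  proof (rule inj_onI)
    fix i j assume ij: "i \<in> {1..int n}" "j \<in> {1..int n}" "\<bar>p i\<bar> = \<bar>p j\<bar>"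
    \<comment> \<open>Oddness rewrites \<open>- p j\<close> as \<open>p (- j)\<close>, so
      injectivity of \<open>p\<close> leaves \<open>i = j\<close> or \<open>i = - j\<close>, and the
      latter is impossible for positive arguments.\<close>
    then have "p i = p j \<or> p i = p (- j)" using odd[of j] by linarith
    then show "i = j" using ij inj by auto
  qed
  moreover have "(\<lambda>i. \<bar>p i\<bar>) ` {1..int n} = {1..int n}"
  proof (intro card_subset_eq)
    show "(\<lambda>i. \<bar>p i\<bar>) ` {1..int n} \<subseteq> {1..int n}"
    proof
      fix y assume "y \<in> (\<lambda>i. \<bar>p i\<bar>) ` {1..int n}"
      then obtain i where "i \<in> {1..int n}" "y = \<bar>p i\<bar>" by auto
      moreover from this have "p i \<in> {- int n..int n} - {0}"
        using permutes_in_image[OF p, of i] by auto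
      ultimately show "y \<in> {1..int n}" by auto
    qed
  qed (use calculation in \<open>auto simp: card_image\<close>)
  ultimately show "map p [1..int n] \<in> signed_words {1..int n}"
    by (simp add: signed_words_def image_image) (simp add: distinct_map o_def)
next
  fix l assume l: "l \<in> signed_words {1..int n}"
  then have "length (map abs l) = card {1..int n}"
    unfolding signed_words_def by (metis (mono_tags, lifting) distinct_card list.set_map mem_Collect_eq)
  then have len: "length l = n" by simp
  let ?S = "{- int n..int n} - {0}"
  \<comment> \<open>The odd extension of the word; list indices start at 0, hence the shift by
    1.\<close>
  define p where "p i = (if i \<in> {1..int n} then l ! nat (i - 1)
    else if - i \<in> {1..int n} then - l ! nat (- i - 1) else i)" for i
  have odd: "p (- i) = - p i" for i by (auto simp: p_def)
  have pos: "p ` {1..int n} = set l"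
    using set_conv_nth_int[of l] len by (simp add: p_def cong: image_cong_simp)
  have "?S = {1..int n} \<union> uminus ` {1..int n}"
  proof (intro equalityI subsetI)
    fix x assume "x \<in> ?S"
    then show "x \<in> {1..int n} \<union> uminus ` {1..int n}"
      by (cases "x > 0") (auto intro: image_eqI[of _ _ "- x"])
  qed auto
  then have "p ` ?S = set l \<union> uminus ` set l"
    by (simp only: image_Un image_image odd pos[symmetric])
  also have "\<dots> = ?S"
  proof (intro equalityI subsetI)
    fix x assume "x \<in> set l \<union> uminus ` set l"
    then have "\<bar>x\<bar> \<in> abs ` set l" by auto
    then show "x \<in> ?S" using l by (auto simp: signed_words_def)
  next
    fix x assume "x \<in> ?S"
    then have "\<bar>x\<bar> \<in> abs ` set l" using l by (auto simp: signed_words_def)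
    then obtain y where "y \<in> set l" "x = y \<or> x = - y" by (auto simp: abs_eq_iff)
    then show "x \<in> set l \<union> uminus ` set l" by auto
  qed
  finally have "p permutes ?S"
    by (intro permutes_if_image_eq) (auto simp: p_def)
  then have "p \<in> signed_perms n" using odd by (simp add: signed_perms_def)
  moreover have "l = map p [1..int n]"
    using len by (auto simp: p_def intro!: nth_equalityI)
  ultimately show "\<exists>p\<in>signed_perms n. l = map p [1..int n]" by blast
qed

section \<open>Standardization: descent sums depend only on the size of the alphabet\<close>

lemma ex_strict_mono_enumeration:
  fixes S :: "int set"
  assumes "finite S"
  shows "\<exists>f. strict_mono_on {1..int (card S)} f \<and> f ` {1..int (card S)} = S"
proof (intro exI conjI)
  let ?l = "sorted_list_of_set S"
  let ?f = "\<lambda>i. ?l ! nat (i - 1)"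
  show "strict_mono_on {1..int (card S)} ?f"
    by (auto intro!: strict_mono_onI sorted_wrt_nth_less[of "(<)"])
  show "?f ` {1..int (card S)} = S"
    using set_conv_nth_int[of ?l] assms by simp
qed

text \<open>Increasing relabelling preserves descents. The set may contain negative numbers, which
  is what the negative prefixes and the mixed choices of signs require.\<close>

lemma sum_des_permutations_of_set:
  assumes "finite S"
  shows "(\<Sum>l\<in>permutations_of_set S. monom 1 (des l)) = A_poly (card S)"
proof -
  let ?n = "card S"
  obtain f where f: "strict_mono_on {1..int ?n} f" "f ` {1..int ?n} = S"
    using ex_strict_mono_enumeration[OF assms] by blast
  have inj: "inj_on f {1..int ?n}" using f(1) by (rule strict_mono_on_imp_inj_on)
  have "inj_on (map f) (permutations_of_set {1..int ?n})"
    by (rule inj_on_mapI, rule inj_on_subset[OF inj]) (auto simp: permutations_of_set_def)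
  then have "(\<Sum>l\<in>permutations_of_set S. monom 1 (des l)) =
      (\<Sum>l\<in>permutations_of_set {1..int ?n}. monom (1 :: rat) (des (map f l)))"
    using permutations_of_set_image_inj[OF inj] by (simp add: f(2) sum.reindex)
  also have "\<dots> = (\<Sum>l\<in>permutations_of_set {1..int ?n}. monom 1 (des l))"
    by (intro sum.cong refl arg_cong[of _ _ "monom 1"] des_map_strict_mono_on[OF f(1)])
       (auto simp: permutations_of_set_def)
  also have "\<dots> = A_poly ?n"
    by (simp add: A_poly_def des_A_def des_map_upto flip: sum.reindex_bij_betw[OF bij_betw_sym_perms])
  finally show ?thesis .
qed

text \<open>Here \<open>s\<close> is the sign of the prefix that has been cut off, so the remainder
  starts with the opposite sign: \<open>s = -1\<close> gives words with positive first letter,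
  \<open>s = 1\<close> those with negative first letter. The empty word stands for a cut at the very
  end.\<close>

definition half_words :: "int \<Rightarrow> int set \<Rightarrow> int list set" where
  "half_words s S = {l \<in> signed_words S. l = [] \<or> s * hd l < 0}"

text \<open>
  The auxiliary prefix \<open>e\<close> is either empty, so that descents are counted as in \<open>des_A\<close>, or \<open>[0]\<close>,
  which accounts for \<open>\<pi> 0 = 0\<close> in \<open>des_B\<close>.
\<close>

definition half_poly :: "int list \<Rightarrow> int \<Rightarrow> nat \<Rightarrow> rat poly" where
  "half_poly e s n = (\<Sum>l\<in>half_words s {1..int n}. monom 1 (des (e @ l)))"

text \<open>The increasing enumeration of \<open>S\<close> extends to an odd function that is still
  increasing, since \<open>S\<close> is positive. It preserves signs and fixes 0, hence respects the
  condition on the first letter and the prefix \<open>e\<close>.\<close>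

lemma sum_des_half_words:
  assumes "finite S" "S \<subseteq> {1..}" "set e \<subseteq> {0}"
  shows "(\<Sum>l\<in>half_words s S. monom 1 (des (e @ l))) = half_poly e s (card S)"
proof -
  let ?n = "int (card S)"
  obtain f where f: "strict_mono_on {1..?n} f" "f ` {1..?n} = S"
    using ex_strict_mono_enumeration[OF assms(1)] by blast
  have inj_f: "inj_on f {1..?n}" using f(1) by (rule strict_mono_on_imp_inj_on)
  have f_pos: "f i \<ge> 1" if "i \<in> {1..?n}" for i using f(2) assms(2) that by auto
  \<comment> \<open>The odd extension of \<open>f\<close>; the factor \<open>sgn i\<close> forces
    the value 0 at 0.\<close>
  define g where "g i = sgn i * f \<bar>i\<bar>" for i
  have g_simps: "g i = f i" "g (- i) = - f i" if "i \<in> {1..?n}" for i 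
    using that by (auto simp: g_def)
  have g_0: "g 0 = 0" by (simp add: g_def)
  have sgn_g: "sgn (g i) = sgn i" and abs_g: "\<bar>g i\<bar> = f \<bar>i\<bar>" if "\<bar>i\<bar> \<in> {1..?n}" for i
    using f_pos[OF that] that by (auto simp: g_def sgn_mult abs_mult)
  have g: "strict_mono_on {- ?n..?n} g"
  proof (rule strict_mono_onI)
    fix i j assume ij: "i \<in> {- ?n..?n}" "j \<in> {- ?n..?n}" "i < j"
    consider "i > 0" | "j < 0" | "i \<le> 0" "0 \<le> j" using ij by linarith
    then show "g i < g j"
    proof cases
      case 1
      then show ?thesis using ij strict_mono_onD[OF f(1), of i j] by (simp add: g_def)
    next
      case 2
      then show ?thesis using ij strict_mono_onD[OF f(1), of "- j" "- i"] by (simp add: g_def)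
    next
      case 3
      have "sgn (g i) = sgn i" "sgn (g j) = sgn j"
        using sgn_g[of i] sgn_g[of j] g_0 ij by (cases "i = 0"; cases "j = 0"; force)+
      then show ?thesis using 3 ij(3) by (auto simp: sgn_if split: if_splits)
    qed
  qed
  then have inj_g: "inj_on g {- ?n..?n}" by (rule strict_mono_on_imp_inj_on)
  let ?D = "{i. \<bar>i\<bar> \<in> {1..?n}}"
  have dom: "set l \<subseteq> ?D" if "l \<in> signed_words {1..?n}" for l
    using that by (auto simp: signed_words_def)
  have D: "?D \<subseteq> {- ?n..?n}" by auto
  have mem_iff: "map g l \<in> signed_words S \<longleftrightarrow> l \<in> signed_words {1..?n}"
    if l: "set l \<subseteq> ?D" for l
  proof -
    have sub: "abs ` set l \<subseteq> {1..?n}" using l by auto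
    have abs_map: "map abs (map g l) = map f (map abs l)"
      using abs_g l by auto
    have "distinct (map abs (map g l)) \<longleftrightarrow> distinct (map abs l)"
      unfolding abs_map distinct_map[of f] using inj_on_subset[OF inj_f sub] by simp
    moreover have "abs ` set (map g l) = S \<longleftrightarrow> f ` (abs ` set l) = f ` {1..?n}"
      using arg_cong[where f = set, OF abs_map] f(2) by (simp add: image_image)
    ultimately show ?thesis
      using inj_on_image_eq_iff[OF inj_f sub order_refl] by (simp add: signed_words_def)
  qed
  have hd_iff: "s * hd (map g l) < 0 \<longleftrightarrow> s * hd l < 0" if "set l \<subseteq> ?D" "l \<noteq> []" for l
  proof -
    have "sgn (g (hd l)) = sgn (hd l)" using that hd_in_set by (intro sgn_g) blast
    then show ?thesis
      using that(2) by (auto simp: hd_map mult_less_0_iff sgn_if split: if_splits)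
  qed
  have "half_words s S = map g ` half_words s {1..?n}"
  proof (intro equalityI subsetI)
    fix l assume l: "l \<in> half_words s S"
    have "\<exists>i. \<bar>i\<bar> \<in> {1..?n} \<and> x = g i" if "x \<in> set l" for x
    proof -
      have "\<bar>x\<bar> \<in> S" using l that by (auto simp: half_words_def signed_words_def)
      then obtain i where "i \<in> {1..?n}" "\<bar>x\<bar> = f i" using f(2) by blast
      then show ?thesis
        \<comment> \<open>The preimage of a letter takes its sign from the letter and its absolute
          value from \<open>f\<close>.\<close>
        using g_simps[of i] by (intro exI[of _ "if x \<ge> 0 then i else - i"]) auto
    qed
    then obtain h where h: "\<And>x. x \<in> set l \<Longrightarrow> \<bar>h x\<bar> \<in> {1..?n} \<and> x = g (h x)" by metis
    have l': "set (map h l) \<subseteq> ?D" using h by auto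
    have eq: "l = map g (map h l)" using h by (auto simp: map_idI)
    have "map h l \<in> half_words s {1..?n}"
      using l mem_iff[OF l'] hd_iff[OF l'] eq by (auto simp: half_words_def simp del: map_map)
    then show "l \<in> map g ` half_words s {1..?n}" using eq by blast
  next
    fix l assume "l \<in> map g ` half_words s {1..?n}"
    then obtain l' where "l = map g l'" "l' \<in> signed_words {1..?n}" "l' = [] \<or> s * hd l' < 0"
      by (auto simp: half_words_def)
    then show "l \<in> half_words s S"
      using mem_iff[OF dom, of l'] hd_iff[OF dom, of l'] by (auto simp: half_words_def)
  qed
  moreover have "inj_on (map g) (half_words s {1..?n})"
    by (rule inj_on_mapI, rule inj_on_subset[OF inj_g])
       (use dom D in \<open>auto simp: half_words_def\<close>)
  ultimately have "(\<Sum>l\<in>half_words s S. monom 1 (des (e @ l))) =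
      (\<Sum>l\<in>half_words s {1..?n}. monom (1 :: rat) (des (e @ map g l)))"
    by (simp add: sum.reindex)
  also have "\<dots> = half_poly e s (card S)"
    unfolding half_poly_def
  proof (intro sum.cong refl arg_cong[of _ _ "monom 1"])
    fix l assume "l \<in> half_words s {1..?n}"
    then have "set l \<subseteq> ?D" by (intro dom) (simp add: half_words_def)
    then have "set (e @ l) \<subseteq> {- ?n..?n}" using D assms(3) by auto
    moreover have "e @ map g l = map g (e @ l)"
      using assms(3) g_0 by (auto simp: map_idI[symmetric] intro!: map_idI[symmetric])
    ultimately show "des (e @ map g l) = des (e @ l)"
      using des_map_strict_mono_on[OF g] by metis
  qed
  finally show ?thesis .
qed

section \<open>Cutting after the longest prefix of constant sign\<close>

text \<open>\<open>T\<close> holds the absolute values of the prefix \<open>u\<close>. All letters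
  of \<open>u\<close> have sign \<open>s\<close> while \<open>v\<close> is empty or starts with the
  other sign, so \<open>takeWhile\<close> and \<open>dropWhile\<close> recover the cut.\<close>

lemma bij_betw_signed_words_split:
  assumes "s \<in> {1, -1}" "S \<subseteq> {1..}"
  shows "bij_betw (\<lambda>(T, u, v). u @ v)
    (SIGMA T:Pow S. permutations_of_set ((*) s ` T) \<times> half_words s (S - T)) (signed_words S)"
proof (rule bij_betw_byWitness[where f' = "\<lambda>l. (abs ` set (takeWhile (\<lambda>x. s * x > 0) l),
      takeWhile (\<lambda>x. s * x > 0) l, dropWhile (\<lambda>x. s * x > 0) l)"], goal_cases)
  case 1
  have *: "takeWhile (\<lambda>x. s * x > 0) (u @ v) = u \<and> dropWhile (\<lambda>x. s * x > 0) (u @ v) = v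
      \<and> abs ` set u = T"
    if T: "T \<subseteq> S" and u: "set u = (*) s ` T" and v: "v \<in> half_words s (S - T)" for T u v
  proof -
    have "\<forall>x\<in>set u. s * x > 0"
      using assms T u by (auto simp flip: mult.assoc)
    moreover have "takeWhile (\<lambda>x. s * x > 0) v = []" "dropWhile (\<lambda>x. s * x > 0) v = v"
      using v by (cases v; force simp: half_words_def)+
    moreover have "abs ` set u = T"
    proof -
      have "abs ` set u = (\<lambda>x. x) ` T"
        unfolding u image_image using assms T by (intro image_cong) (auto simp: abs_mult)
      then show ?thesis by simp
    qed
    ultimately show ?thesis by simp
  qed
  show ?case
  proof (rule ballI, goal_cases)
    case (1 t)
    then obtain T u v where t: "t = (T, u, v)" "T \<subseteq> S" "set u = (*) s ` T" "v \<in> half_words s (S - T)"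
      by (auto simp: permutations_of_set_def)
    show ?case using *[OF t(2-4)] by (simp only: t(1) prod.case)
  qed
next
  case 2
  then show ?case by simp
next
  case 3
  have "u @ v \<in> signed_words S"
    if T: "T \<subseteq> S" and u: "set u = (*) s ` T" "distinct u" and v: "v \<in> half_words s (S - T)" for T u v
  proof -
    have abs_s: "\<bar>s * x\<bar> = x" if "x \<in> T" for x using that assms T by (auto simp: abs_mult)
    have "abs ` set u = (\<lambda>x. x) ` T"
      unfolding u image_image using abs_s by (intro image_cong) auto
    moreover have "inj_on abs (set u)"
      unfolding u by (rule inj_onI) (use abs_s in auto)
    then have "distinct (map abs u)" using u(2) by (simp add: distinct_map)
    ultimately show ?thesis
      using T v by (auto simp: half_words_def signed_words_def)
  qed
  then show ?case by (auto simp: permutations_of_set_def)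
next
  case 4
  have *: "(abs ` set u, u, v) \<in> (SIGMA T:Pow S. permutations_of_set ((*) s ` T) \<times> half_words s (S - T))"
    if l: "u @ v \<in> signed_words S" and u: "\<And>x. x \<in> set u \<Longrightarrow> s * x > 0"
      and v: "v \<noteq> [] \<Longrightarrow> \<not> s * hd v > 0" for u v
  proof -
    have d: "distinct (map abs u)" "distinct (map abs v)" "abs ` set u \<inter> abs ` set v = {}"
      and S: "abs ` set u \<union> abs ` set v = S"
      using l by (auto simp: signed_words_def)
    have "(*) s ` abs ` set u = (\<lambda>x. x) ` set u"
      unfolding image_image by (intro image_cong refl) (use u assms(1) in force)
    \<comment> \<open>Failing to have sign \<open>s\<close> leaves zero or the opposite sign; zero
      is excluded because absolute values are at least 1.\<close>
    moreover have "hd v \<noteq> 0" if "v \<noteq> []"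
      using S assms(2) hd_in_set[OF that] by force
    then have "v \<noteq> [] \<Longrightarrow> s * hd v < 0" using v assms(1) by force
    ultimately show ?thesis
      using d S by (auto simp: permutations_of_set_def half_words_def signed_words_def distinct_map)
  qed
  show ?case
  proof (rule image_subsetI, goal_cases)
    case (1 l)
    then show ?case using hd_dropWhile by (intro *) (auto dest: set_takeWhileD simp del: dropWhile_eq_Nil_conv)
  qed
qed

text \<open>Grouping subsets by size produces the binomial coefficients of the convolution.\<close>

lemma sum_Pow_card:
  fixes f :: "nat \<Rightarrow> 'a :: comm_semiring_1"
  assumes "finite S"
  shows "(\<Sum>T\<in>Pow S. f (card T)) = (\<Sum>k\<le>card S. of_nat (card S choose k) * f k)"
proof -
  have "(\<Sum>T\<in>Pow S. f (card T)) = (\<Sum>k\<le>card S. \<Sum>T | T \<in> Pow S \<and> card T = k. f (card T))"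
    using assms by (intro sum.group[symmetric]) (auto intro: card_mono)
  also have "\<dots> = (\<Sum>k\<le>card S. of_nat (card S choose k) * f k)"
    using n_subsets[OF assms] by (intro sum.cong refl) (simp add: Pow_def)
  finally show ?thesis .
qed

text \<open>For fixed \<open>T\<close> descents add over the two parts, so the sum factors, and by
  standardization both factors depend only on the size of \<open>T\<close>.\<close>

lemma sum_des_signed_words:
  assumes "finite S" "S \<subseteq> {1..}" and es: "(e, s) \<in> {([], -1), ([0], 1)}"
  shows "(\<Sum>l\<in>signed_words S. monom 1 (des (e @ l))) =
    (\<Sum>k\<le>card S. of_nat (card S choose k) * (A_poly k * half_poly e s (card S - k)))"
proof -
  have s: "s \<in> {1, -1}" and e: "set e \<subseteq> {0}" using es by auto
  have fin: "finite (half_words s T)" if "T \<subseteq> S" for T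
    unfolding half_words_def
    by (rule finite_subset[OF _ finite_signed_words[OF finite_subset[OF that assms(1)]]]) auto
  \<comment> \<open>Let \<open>u\<close> and \<open>v\<close> be nonempty. For \<open>e = []\<close>
    the cut goes from a negative to a positive letter, an ascent. For \<open>e = [0]\<close> the
    step from 0 into \<open>u\<close> is an ascent, and the descent at the cut matches the descent
    from 0 to \<open>hd v\<close> counted by \<open>des (e @ v)\<close>.\<close>
  have split: "des (e @ u @ v) = des u + des (e @ v)"
    if "T \<subseteq> S" "u \<in> permutations_of_set ((*) s ` T)" "v \<in> half_words s (S - T)" for T u v
  proof (cases "u = []")
    case False
    have pos: "s * x > 0" if "x \<in> set u" for x
      using \<open>T \<subseteq> S\<close> \<open>u \<in> _\<close> that s assms(2) by (auto simp: permutations_of_set_def)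
    have "s * last u > 0" "s * hd u > 0" using False by (auto intro: pos)
    moreover have "v \<noteq> [] \<Longrightarrow> s * hd v < 0" using that by (auto simp: half_words_def)
    ultimately show ?thesis
      using es False by (cases "v = []") (auto simp: des_append des_append[of "[0]", simplified])
  qed simp
  have "(\<Sum>l\<in>signed_words S. monom (1 :: rat) (des (e @ l))) =
      (\<Sum>(T, u, v)\<in>(SIGMA T:Pow S. permutations_of_set ((*) s ` T) \<times> half_words s (S - T)).
        monom 1 (des (e @ u @ v)))"
    by (subst sum.reindex_bij_betw[OF bij_betw_signed_words_split[OF s assms(2)], symmetric])
       (simp add: case_prod_unfold)
  also have "\<dots> = (\<Sum>T\<in>Pow S. \<Sum>(u, v)\<in>permutations_of_set ((*) s ` T) \<times> half_words s (S - T).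
      monom 1 (des (e @ u @ v)))"
    by (subst sum.Sigma) (use assms(1) fin in auto)
  also have "\<dots> = (\<Sum>T\<in>Pow S. A_poly (card T) * half_poly e s (card S - card T))"
  proof (rule sum.cong[OF refl])
    fix T assume "T \<in> Pow S"
    then have T: "T \<subseteq> S" "finite T" using assms(1) finite_subset by auto
    have "card ((*) s ` T) = card T"
      using s by (intro card_image) (auto simp: inj_on_def)
    then have A: "(\<Sum>u\<in>permutations_of_set ((*) s ` T). monom 1 (des u)) = A_poly (card T)"
      using sum_des_permutations_of_set[of "(*) s ` T"] T by simp
    have "card (S - T) = card S - card T" using T by (simp add: card_Diff_subset)
    then have H: "(\<Sum>v\<in>half_words s (S - T). monom 1 (des (e @ v))) = half_poly e s (card S - card T)"
      using sum_des_half_words[of "S - T" e s] assms e by auto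
    show "(\<Sum>(u, v)\<in>permutations_of_set ((*) s ` T) \<times> half_words s (S - T). monom 1 (des (e @ u @ v)))
        = A_poly (card T) * half_poly e s (card S - card T)"
      unfolding A[symmetric] H[symmetric] sum_product sum.cartesian_product
      by (intro sum.cong refl) (auto simp: split[OF T(1)] mult_monom)
  qed
  also have "\<dots> = (\<Sum>k\<le>card S. of_nat (card S choose k) * (A_poly k * half_poly e s (card S - k)))"
    using sum_Pow_card[OF assms(1), of "\<lambda>k. A_poly k * half_poly e s (card S - k)"] .
  finally show ?thesis .
qed

section \<open>Choosing the negative letters\<close>

text \<open>\<open>T\<close> consists of the absolute values of the negative letters; it can be read
  off the word because \<open>S\<close> is positive.\<close>

lemma bij_betw_signed_words_signs:
  assumes "S \<subseteq> {1..}"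
  shows "bij_betw snd (SIGMA T:Pow S. permutations_of_set ((S - T) \<union> uminus ` T)) (signed_words S)"
proof (rule bij_betw_byWitness[where f' = "\<lambda>l. (uminus ` (set l \<inter> {..<0}), l)"], goal_cases)
  case 1
  have "uminus ` (((S - T) \<union> uminus ` T) \<inter> {..<0}) = T" if "T \<subseteq> S" for T
  proof -
    have "S \<inter> {..<0} = {}" "uminus ` T \<subseteq> {..<0}" using assms that by fastforce+
    then have "((S - T) \<union> uminus ` T) \<inter> {..<0} = uminus ` T" by blast
    then show ?thesis by (simp add: image_image)
  qed
  then show ?case by (auto simp: permutations_of_set_def)
next
  case 2
  then show ?case by simp
next
  case 3
  have "l \<in> signed_words S"
    if T: "T \<subseteq> S" and l: "set l = (S - T) \<union> uminus ` T" "distinct l" for T l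
  proof -
    have "inj_on abs (set l)"
    proof (rule inj_onI)
      fix x y assume xy: "x \<in> set l" "y \<in> set l" "\<bar>x\<bar> = \<bar>y\<bar>"
      have mem: "z \<in> S - T \<or> - z \<in> T" if "z \<in> set l" for z
        using that unfolding l by auto
      have pos: "1 \<le> z" if "z \<in> S" for z using that assms by auto
      \<comment> \<open>A letter and its negative cannot both occur: positive letters lie outside
        \<open>T\<close>, while negative ones have their absolute value in \<open>T\<close>.\<close>
      have "False" if "y = - x"
        using mem[OF xy(1)] mem[OF xy(2)] pos[of x] pos[of "- x"]
          subsetD[OF T, of x] subsetD[OF T, of "- x"] that by auto
      then show "x = y" using xy(3) by (auto simp: abs_eq_iff)
    qed
    moreover have "abs ` set l = S"
    proof -
      have "abs ` (S - T) = (\<lambda>x. x) ` (S - T)" "abs ` uminus ` T = (\<lambda>x. x) ` T"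
        unfolding image_image using assms T by (intro image_cong; force)+
      then show ?thesis using l T by (auto simp: image_Un)
    qed
    ultimately show ?thesis using l by (simp add: signed_words_def distinct_map)
  qed
  then show ?case by (auto simp: permutations_of_set_def)
next
  case 4
  have *: "set l = (S - uminus ` (set l \<inter> {..<0})) \<union> uminus ` uminus ` (set l \<inter> {..<0})"
    "uminus ` (set l \<inter> {..<0}) \<subseteq> S" if "l \<in> signed_words S" for l
  proof -
    have inj: "inj_on abs (set l)" and S: "abs ` set l = S"
      using that by (auto simp: signed_words_def distinct_map)
    show "uminus ` (set l \<inter> {..<0}) \<subseteq> S"
      using S by force
    have "x \<in> S - uminus ` (set l \<inter> {..<0})" if x: "x \<in> set l" "\<not> x < 0" for x
    proof -
      have "x \<in> S" using x S by force
      moreover have "False" if "y \<in> set l" "y < 0" "x = - y" for y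
        using inj_onD[OF inj, of x y] x that by simp
      ultimately show ?thesis by auto
    qed
    moreover have "x \<in> set l" if x: "x \<in> S" "x \<notin> uminus ` (set l \<inter> {..<0})" for x
    proof -
      obtain y where "y \<in> set l" "x = \<bar>y\<bar>" using S x(1) by auto
      then show ?thesis using x(2) by (cases "y < 0") auto
    qed
    ultimately show "set l = (S - uminus ` (set l \<inter> {..<0})) \<union> uminus ` uminus ` (set l \<inter> {..<0})"
      by (auto simp: image_image)
  qed
  show ?case
  proof (rule image_subsetI, goal_cases)
    case (1 l)
    moreover from this have "distinct l" by (simp add: signed_words_def distinct_map)
    ultimately show ?case by (intro SigmaI PowI permutations_of_setI *)
  qed
qed

text \<open>Each of the \<open>2 ^ card S\<close> choices of \<open>T\<close> yields an alphabet of
  the same size and thus, by standardization, the same sum.\<close>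

lemma sum_des_signed_words_eq_A_poly:
  assumes "finite S" "S \<subseteq> {1..}"
  shows "(\<Sum>l\<in>signed_words S. monom 1 (des l)) = 2 ^ card S * A_poly (card S)"
proof -
  have "(\<Sum>l\<in>signed_words S. monom (1 :: rat) (des l)) =
      (\<Sum>T\<in>Pow S. \<Sum>l\<in>permutations_of_set ((S - T) \<union> uminus ` T). monom 1 (des l))"
    by (subst sum.reindex_bij_betw[OF bij_betw_signed_words_signs[OF assms(2)], symmetric], subst sum.Sigma)
       (use assms(1) in \<open>auto simp: case_prod_unfold\<close>)
  also have "\<dots> = (\<Sum>T\<in>Pow S. A_poly (card S))"
  proof (rule sum.cong[OF refl])
    fix T assume "T \<in> Pow S"
    then have T: "T \<subseteq> S" "finite T" using assms(1) finite_subset by auto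
    have "uminus ` T \<subseteq> {..- 1}" using assms(2) T(1) by fastforce
    moreover have "{1..} \<inter> {..- 1 :: int} = {}" by auto
    ultimately have "(S - T) \<inter> uminus ` T = {}" using assms(2) by blast
    then have "card ((S - T) \<union> uminus ` T) = card (S - T) + card (uminus ` T)"
      using assms(1) T(2) by (intro card_Un_disjoint) auto
    also have "\<dots> = card S"
      using T assms(1) card_mono[OF assms(1) T(1)] by (simp add: card_image card_Diff_subset)
    finally show "(\<Sum>l\<in>permutations_of_set ((S - T) \<union> uminus ` T). monom 1 (des l)) = A_poly (card S)"
      using sum_des_permutations_of_set[of "(S - T) \<union> uminus ` T"] T assms(1) by simp
  qed
  also have "\<dots> = 2 ^ card S * A_poly (card S)"
    using assms(1) by (simp add: card_Pow)
  finally show ?thesis .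
qed

section \<open>From words back to the polynomials\<close>

lemma sum_signed_perms:
  "(\<Sum>p | p \<in> signed_perms n \<and> P (map p [1..int n]). F (map p [1..int n])) =
    (\<Sum>l | l \<in> signed_words {1..int n} \<and> P l. F l)"
proof -
  let ?f = "\<lambda>p. map p [1..int n]"
  have "?f ` {p. p \<in> signed_perms n \<and> P (?f p)} = {l. l \<in> ?f ` signed_perms n \<and> P l}"
    by (rule Compr_image_eq[symmetric])
  also have "?f ` signed_perms n = signed_words {1..int n}"
    by (rule bij_betw_imp_surj_on[OF bij_betw_signed_perms])
  finally have "bij_betw ?f {p. p \<in> signed_perms n \<and> P (?f p)} {l. l \<in> signed_words {1..int n} \<and> P l}"
    by (rule bij_betw_subset[OF bij_betw_signed_perms Collect_restrict])
  from sum.reindex_bij_betw[OF this, of F] show ?thesis .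
qed

lemma signed_words_empty: "signed_words {} = {[]}"
  by (auto simp: signed_words_def)

text \<open>Only the empty word contributes; this is the constant term 1 in both identities.\<close>

lemma half_poly_0: "set e \<subseteq> {0} \<Longrightarrow> length e \<le> 1 \<Longrightarrow> half_poly e s 0 = 1"
  by (cases e) (auto simp: half_poly_def half_words_def signed_words_empty Collect_conv_if)

lemma half_words_pos: "n > 0 \<Longrightarrow> half_words s {1..int n} = {l \<in> signed_words {1..int n}. s * hd l < 0}"
  by (auto simp: half_words_def signed_words_def)

lemma hd_map_upto: "n > 0 \<Longrightarrow> hd (map p [1..int n]) = p 1"
  by (simp add: upto_rec1)

lemma des_A_eq: "des_A n p = des (map p [1..int n])"
  by (simp add: des_A_def des_map_upto)

lemma CE_poly_eq: "n > 0 \<Longrightarrow> CE_poly n = half_poly [] (-1) n"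
  using sum_signed_perms[where n = n and P = "\<lambda>l. hd l > 0" and F = "\<lambda>l. monom (1 :: rat) (des l)"]
  by (simp add: CE_poly_def C_plus_def half_poly_def half_words_pos hd_map_upto des_A_eq)

text \<open>The leading 0 adds exactly one descent in front of a negative first letter, which is the
  factor \<open>x\<close>.\<close>

lemma CO_poly_eq:
  assumes n: "n > 0"
  shows "[:0, 1:] * CO_poly n = half_poly [0] 1 n"
proof -
  have "half_poly [0] 1 n = (\<Sum>l | l \<in> signed_words {1..int n} \<and> hd l < 0. [:0, 1:] * monom 1 (des l))"
    unfolding half_poly_def half_words_pos[OF n]
  proof (intro sum.cong)
    fix l assume "l \<in> {l. l \<in> signed_words {1..int n} \<and> hd l < 0}"
    then have "hd l < 0" "l \<noteq> []" using n by (auto simp: signed_words_def)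
    then show "monom (1 :: rat) (des ([0] @ l)) = [:0, 1:] * monom 1 (des l)"
      by (cases l) (auto simp: monom_Suc)
  qed auto
  also have "\<dots> = [:0, 1:] * (\<Sum>l | l \<in> signed_words {1..int n} \<and> hd l < 0. monom 1 (des l))"
    by (rule sum_distrib_left[symmetric])
  also have "(\<Sum>l | l \<in> signed_words {1..int n} \<and> hd l < 0. monom 1 (des l)) = CO_poly n"
    using sum_signed_perms[where n = n and P = "\<lambda>l. hd l < 0" and F = "\<lambda>l. monom (1 :: rat) (des l)"] n
    by (simp add: CO_poly_def C_minus_def hd_map_upto des_A_eq)
  finally show ?thesis by (rule sym)
qed

lemma B_poly_eq: "B_poly n = (\<Sum>l\<in>signed_words {1..int n}. monom 1 (des (0 # l)))"
proof -
  have "des_B n p = des (0 # map p [1..int n])" if "p \<in> signed_perms n" for p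
    using that des_map_upto[of p 0 "int n"] signed_perms_zero[OF that]
    by (simp add: des_B_def upto_rec1)
  then show ?thesis
    using sum_signed_perms[where n = n and P = "\<lambda>_. True" and F = "\<lambda>l. monom (1 :: rat) (des (0 # l))"]
    by (simp add: B_poly_def)
qed

text \<open>Two evaluations of the descent sum over all signed words: by choice of signs and by
  cutting off the negative prefix.\<close>

lemma A_poly_convolution:
  "2 ^ n * A_poly n = (\<Sum>k\<le>n. of_nat (n choose k) * (A_poly k * half_poly [] (-1) (n - k)))"
  using sum_des_signed_words[of "{1..int n}" "[]" "-1"] sum_des_signed_words_eq_A_poly[of "{1..int n}"]
  by simp

lemma B_poly_convolution:
  "B_poly n = (\<Sum>k\<le>n. of_nat (n choose k) * (A_poly k * half_poly [0] 1 (n - k)))"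
  using sum_des_signed_words[of "{1..int n}" "[0]" 1] by (simp add: B_poly_eq)

section \<open>Exponential generating functions\<close>

lemma to_fract_of_nat: "to_fract (of_nat n) = of_nat n"
  by (induction n) auto

text \<open>Characteristic zero passes from the polynomials to their fraction field; it makes the
  factorials invertible there.\<close>

lemma of_nat_fract_poly_eq_0_iff: "(of_nat n :: rat poly fract) = 0 \<longleftrightarrow> n = 0"
  by (metis of_nat_eq_0_iff to_fract_eq_0_iff to_fract_of_nat)

lemma egf_mult:
  "egf p * egf q = egf (\<lambda>n. \<Sum>k\<le>n. of_nat (n choose k) * (p k * q (n - k)))"
proof (rule fps_ext)
  fix n
  have fact_nz: "(fact k :: rat poly fract) \<noteq> 0" for k
    using of_nat_fract_poly_eq_0_iff[of "fact k"] by simp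
  have "to_fract (p k) / fact k * (to_fract (q (n - k)) / fact (n - k)) =
      to_fract (of_nat (n choose k) * (p k * q (n - k))) / fact n" if "k \<le> n" for k
  proof -
    have "(fact n :: rat poly fract) = fact k * fact (n - k) * of_nat (n choose k)"
      using arg_cong[OF binomial_fact_lemma[OF that], of "of_nat :: nat \<Rightarrow> rat poly fract"] by simp
    then show ?thesis
      using fact_nz[of k] fact_nz[of "n - k"] fact_nz[of n]
      by (simp add: to_fract_of_nat field_simps)
  qed
  then show "fps_nth (egf p * egf q) n =
      fps_nth (egf (\<lambda>n. \<Sum>k\<le>n. of_nat (n choose k) * (p k * q (n - k)))) n"
    by (simp add: egf_def fps_mult_nth atLeast0AtMost sum_divide_distrib)
qed

theorem theorem2p2:
  shows "(A_gf oo (fps_const 2 * fps_X)) / A_gf = CE_gf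
    \<and> B_gf / A_gf = 1 + x_var * CO_gf"
proof
  have A_nz: "A_gf \<noteq> 0" using A_gf_nth_0 by auto
  have CE: "CE_gf = egf (half_poly [] (-1))"
    unfolding CE_gf_def by (intro arg_cong[of _ _ egf] ext) (simp add: CE_poly_eq half_poly_0)
  have two: "to_fract (2 ^ n :: rat poly) = 2 ^ n" for n
    by (metis of_nat_numeral of_nat_power to_fract_of_nat)
  \<comment> \<open>Substituting \<open>2 z\<close> for \<open>z\<close> scales the coefficient of
    index \<open>n\<close> by \<open>2 ^ n\<close>.\<close>
  have "A_gf oo (fps_const 2 * fps_X) = egf (\<lambda>n. 2 ^ n * A_poly n)"
    by (rule fps_ext) (simp add: A_gf_def egf_def two)
  also have "\<dots> = A_gf * CE_gf"
    by (simp add: A_poly_convolution A_gf_def CE egf_mult)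
  finally show "(A_gf oo (fps_const 2 * fps_X)) / A_gf = CE_gf" using A_nz by simp
  \<comment> \<open>At index 0 the summand 1 supplies \<open>half_poly [0] 1 0\<close>, since
    \<open>CO_gf\<close> has constant term 0; at positive indices \<open>CO_poly_eq\<close> absorbs
    the factor \<open>x\<close>.\<close>
  have CO: "1 + x_var * CO_gf = egf (half_poly [0] 1)"
  proof (rule fps_ext)
    fix n show "fps_nth (1 + x_var * CO_gf) n = fps_nth (egf (half_poly [0] 1)) n"
      by (cases "n = 0")
         (auto simp: x_var_def CO_gf_def egf_def half_poly_0 simp flip: CO_poly_eq to_fract_mult)
  qed
  have B: "B_gf = A_gf * (1 + x_var * CO_gf)"
    unfolding CO A_gf_def B_gf_def egf_mult B_poly_convolution ..
  show "B_gf / A_gf = 1 + x_var * CO_gf"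
    unfolding B by (rule nonzero_mult_div_cancel_left[OF A_nz])
qed

end
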